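(* Let $K$ be the comma subgroup of the point reflection group $P$, that is, the subgroup generated by $(\pi_3\pi_1)^3$ and $(\pi_1\pi_2)^4$. Then $K$ is a normal subgroup of $P$ of index $24$, and the factor group $P/K$ is isomorphic to the dihedral group $D_{12}$ of order $24$.
   Context: Fix an equilateral triangle $\Delta_0$ in the Euclidean plane with a horizontal bottom edge and pointing upward. The point reflection group $P$ is the subgroup of the group of Euclidean plane isometries (multiplication is composition of maps) generated by the $180^\circ$ rotations $\pi_1,\pi_2,\pi_3$ about the midpoints of the bottom edge, the left edge, and the right edge of $\Delta_0$, respectively. $D_{12}$ denotes the dihedral group with $24$ elements (the symmetry group of a regular $12$-gon). *)

theory Defs
  imports "HOL-Analysis.Analysis" "HOL-Algebra.Generated_Groups"
begin

text \<open>The Euclidean plane is modelled by the type \<^typ>\<open>complex\<close>, whose metric \<^const>\<open>dist\<close> is the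
  Euclidean one.\<close>

definition plane_isometries :: "(complex \<Rightarrow> complex) monoid" where
  "plane_isometries =
     \<lparr>carrier = {f. bij f \<and> (\<forall>x y. dist (f x) (f y) = dist x y)}, mult = (\<circ>), one = id\<rparr>"

definition rotation_about :: "complex \<Rightarrow> real \<Rightarrow> complex \<Rightarrow> complex" where
  "rotation_about c \<theta> z = c + cis \<theta> * (z - c)"

definition upward_equilateral :: "complex \<Rightarrow> complex \<Rightarrow> complex \<Rightarrow> bool" where
  "upward_equilateral A B C \<longleftrightarrow>
     Im A = Im B \<and> Re A < Re B \<and> Im A < Im C \<and>
     dist A B = dist B C \<and> dist B C = dist C A"

text \<open>For a triangle with bottom left vertex \<open>A\<close>, bottom right vertex \<open>B\<close> and top vertex \<open>C\<close>,
  the half-turns \<open>half_turn A B\<close>, \<open>half_turn A C\<close> and \<open>half_turn B C\<close> are $\pi_1$, $\pi_2$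
  and $\pi_3$, respectively.\<close>

definition half_turn :: "complex \<Rightarrow> complex \<Rightarrow> complex \<Rightarrow> complex" where
  "half_turn X Y = rotation_about (midpoint X Y) pi"

definition point_reflection_group :: "complex \<Rightarrow> complex \<Rightarrow> complex \<Rightarrow> (complex \<Rightarrow> complex) monoid" where
  "point_reflection_group A B C =
     plane_isometries
       \<lparr>carrier := generate plane_isometries {half_turn A B, half_turn A C, half_turn B C}\<rparr>"

definition comma_subgroup :: "complex \<Rightarrow> complex \<Rightarrow> complex \<Rightarrow> (complex \<Rightarrow> complex) set" where
  "comma_subgroup A B C =
     (let P = point_reflection_group A B C;
          p1 = half_turn A B; p2 = half_turn A C; p3 = half_turn B C
      in generate P {(p3 \<otimes>\<^bsub>P\<^esub> p1) [^]\<^bsub>P\<^esub> (3::nat), (p1 \<otimes>\<^bsub>P\<^esub> p2) [^]\<^bsub>P\<^esub> (4::nat)})"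

definition regular_polygon :: "nat \<Rightarrow> complex set" where
  "regular_polygon n = convex hull {cis (2 * pi * real k / real n) |k. k < n}"

text \<open>Indexing convention: \<open>dihedral_group n\<close> is the symmetry group of the regular \<open>n\<close>-gon,
  so for \<open>n \<ge> 3\<close> it has \<open>2 * n\<close> elements.\<close>

definition dihedral_group :: "nat \<Rightarrow> (complex \<Rightarrow> complex) monoid" where
  "dihedral_group n =
     plane_isometries
       \<lparr>carrier := {f \<in> carrier plane_isometries. f ` regular_polygon n = regular_polygon n}\<rparr>"

end

theory Submission
  imports Defs
begin

text \<open>
  A half-turn about a midpoint of \<open>X\<close> and \<open>Y\<close> is \<open>z \<mapsto> X + Y - z\<close>, so the product of two half-turns is a
  translation. Put \<open>u = B - C\<close> and \<open>v = C - A\<close>. Then $\pi_1\pi_2$ and $\pi_3\pi_1$ are the translations by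
  \<open>u\<close> and \<open>v\<close>, and \<open>P\<close> consists of the translations by the vectors of the lattice
  \<open>\<int>u + \<int>v\<close> together with their compositions with $\pi_1$. In other words \<open>P\<close> is the
  semidirect product of \<open>\<int>\<^sup>2\<close> by a group of order two that acts by negation, and \<open>K\<close> is the
  sublattice \<open>\<int>4u + \<int>3v\<close>.

  On the other side, the symmetries of the regular \<open>n\<close>-gon are the maps \<open>z \<mapsto> w z\<close> and
  \<open>z \<mapsto> w (cnj z)\<close> where \<open>w\<close> is an \<open>n\<close>-th root of unity (lemma \<open>carrier_dihedral_group\<close>); here the
  conjugation acts on the rotations by inversion.

  As 3 and 4 are coprime, \<open>(m, n) \<mapsto> 3 m + 4 n\<close> maps \<open>\<int>\<^sup>2\<close> onto \<open>\<int>/12\<int>\<close> with kernel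
  \<open>4\<int> \<times> 3\<int>\<close>. Sending the translation by \<open>m u + n v\<close> to the rotation by
  \<open>3 m + 4 n\<close> twelfths of a full turn, and $\pi_1$ to the conjugation, therefore gives a
  homomorphism from \<open>P\<close> onto the dihedral group with kernel \<open>K\<close>, and all claims follow from the
  first isomorphism theorem. The coordinates \<open>m\<close> and \<open>n\<close> of an element of \<open>P\<close> are well defined
  because the sides \<open>u\<close> and \<open>v\<close> of the triangle are linearly independent
  (lemma \<open>lattice_isometry_inj\<close>).
\<close>

section \<open>Isometries of the plane\<close>

lemma plane_isometries_simps [simp]:
  "mult plane_isometries f g = f \<circ> g" "one plane_isometries = id"
  by (simp_all add: plane_isometries_def)

lemma plane_isometries_iff:
  "f \<in> carrier plane_isometries \<longleftrightarrow> bij f \<and> (\<forall>x y. dist (f x) (f y) = dist x y)"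
  by (simp add: plane_isometries_def)

lemma group_plane_isometries: "group plane_isometries"
proof (rule groupI)
  fix f assume f: "f \<in> carrier plane_isometries"
  then have "dist (inv_into UNIV f x) (inv_into UNIV f y) = dist x y" for x y
    by (metis plane_isometries_iff bij_inv_eq_iff)
  with f show "\<exists>g\<in>carrier plane_isometries. g \<otimes>\<^bsub>plane_isometries\<^esub> f = \<one>\<^bsub>plane_isometries\<^esub>"
    by (intro bexI[of _ "inv_into UNIV f"])
      (auto simp: plane_isometries_iff bij_imp_bij_inv bij_is_inj)
qed (auto simp: plane_isometries_iff bij_comp o_assoc)

interpretation isometries: group plane_isometries
  by (rule group_plane_isometries)

lemma isometry_fixing_0_cases:
  fixes f :: "complex \<Rightarrow> complex"
  assumes "f 0 = 0" and "\<And>x y. dist (f x) (f y) = dist x y"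
  shows "f = (\<lambda>z. f 1 * z) \<or> f = (\<lambda>z. f 1 * cnj z)"
proof -
  have "linear f"
    using assms by (intro isometry_linear) auto
  then interpret linear f .
  have norm_f [simp]: "cmod (f z) = cmod z" for z
    using assms(2)[of z 0] assms(1) by simp
  have "f 1 \<noteq> 0"
    using norm_f[of 1] by (auto simp del: norm_f)
  define q where "q = f \<i> / f 1"
  have fi: "f \<i> = f 1 * q"
    using \<open>f 1 \<noteq> 0\<close> by (simp add: q_def)
  \<comment> \<open>The image of \<open>\<i>\<close>, in units of \<open>f 1\<close>, lies on the unit circle at the same
      distance from \<open>1\<close> as \<open>\<i>\<close>, so it is one of \<open>\<i>\<close> and \<open>-\<i>\<close>.\<close>
  have "cmod q = 1"
    by (simp add: q_def norm_divide)
  moreover have "cmod (1 - q) = cmod (1 - \<i>)"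
  proof -
    have "cmod (f 1) * cmod (1 - q) = cmod (f 1 - f \<i>)"
      by (simp only: fi right_diff_distrib mult_1_right flip: norm_mult)
    also have "\<dots> = cmod (1 - \<i>)"
      using assms(2)[of 1 \<i>] by (simp add: dist_norm)
    finally show ?thesis by simp
  qed
  ultimately have sq: "(Re q)\<^sup>2 + (Im q)\<^sup>2 = 1" "(1 - Re q)\<^sup>2 + (Im q)\<^sup>2 = 2"
    by (simp_all add: cmod_def)
  then have "Re q = 0"
    by (simp add: power2_eq_square algebra_simps)
  with sq have "q = \<i> \<or> q = - \<i>"
    by (auto simp: complex_eq_iff power2_eq_1_iff)
  moreover have "f z = f 1 * (of_real (Re z) + of_real (Im z) * q)" for z
  proof -
    have "f z = f (Re z *\<^sub>R 1 + Im z *\<^sub>R \<i>)"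
      by (rule arg_cong[of _ _ f]) (simp add: complex_eq_iff)
    also have "\<dots> = Re z *\<^sub>R f 1 + Im z *\<^sub>R f \<i>"
      by (simp only: add scale)
    finally show ?thesis
      by (simp add: fi scaleR_conv_of_real algebra_simps)
  qed
  moreover have "z = of_real (Re z) + of_real (Im z) * \<i>"
    and "cnj z = of_real (Re z) + of_real (Im z) * - \<i>" for z
    by (simp_all add: complex_eq_iff)
  ultimately show ?thesis
    by metis
qed

section \<open>Symmetries of a regular polygon\<close>

text \<open>The flag tells the orientation-preserving maps from the reversing ones. Keeping both kinds in one
  formula makes composition a single rule, in which the flags multiply like signs.\<close>

definition polygon_symmetry :: "bool \<Rightarrow> complex \<Rightarrow> complex \<Rightarrow> complex" where
  "polygon_symmetry e w z = w * (if e then z else cnj z)"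

lemma polygon_symmetry_comp:
  "polygon_symmetry e w \<circ> polygon_symmetry e' w' =
     polygon_symmetry (e = e') (w * (if e then w' else cnj w'))"
  by (auto simp: polygon_symmetry_def fun_eq_iff)

lemma polygon_symmetry_eq_iff:
  assumes "w \<noteq> 0"
  shows "polygon_symmetry e w = polygon_symmetry e' w' \<longleftrightarrow> e = e' \<and> w = w'"
proof
  assume eq: "polygon_symmetry e w = polygon_symmetry e' w'"
  from fun_cong[OF eq, of 1] fun_cong[OF eq, of \<i>] assms show "e = e' \<and> w = w'"
    by (cases e; cases e') (auto simp: polygon_symmetry_def)
qed auto

lemma polygon_symmetry_eq_id_iff:
  assumes "w \<noteq> 0"
  shows "polygon_symmetry e w = id \<longleftrightarrow> e \<and> w = 1"
proof -
  have "id = polygon_symmetry True 1"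
    by (simp add: polygon_symmetry_def fun_eq_iff)
  then show ?thesis
    using polygon_symmetry_eq_iff[OF assms, of e True 1] by simp
qed

lemma polygon_symmetry_isometry:
  assumes "cmod w = 1"
  shows "polygon_symmetry e w \<in> carrier plane_isometries"
proof -
  have "w * cnj w = 1"
    by (simp add: complex_norm_square[symmetric] assms)
  then have "bij (polygon_symmetry e w)"
    by (intro o_bij[of "polygon_symmetry e (if e then cnj w else w)"])
      (auto simp: polygon_symmetry_comp fun_eq_iff polygon_symmetry_def mult.commute)
  moreover have "dist (polygon_symmetry e w x) (polygon_symmetry e w y) = dist x y" for x y
    using assms
    by (simp add: polygon_symmetry_def dist_norm norm_mult
        flip: right_diff_distrib complex_cnj_diff)
  ultimately show ?thesis
    by (simp add: plane_isometries_iff)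
qed

lemma regular_polygon_eq_hull_roots:
  assumes "n > 0"
  shows "regular_polygon n = convex hull {z. z ^ n = 1}"
proof -
  have "{cis (2 * pi * real k / real n) |k. k < n} = {z. z ^ n = 1}"
    using bij_betw_imp_surj_on[OF Complex.bij_betw_roots_unity[OF assms]] by auto
  then show ?thesis
    by (simp add: regular_polygon_def)
qed

lemma norm_root_unity:
  fixes z :: complex
  assumes "z ^ n = 1" "n > 0"
  shows "cmod z = 1"
  using assms by (metis power_eq_1_iff gr_implies_not0)

lemma regular_polygon_subset_cball:
  assumes "n > 0"
  shows "regular_polygon n \<subseteq> cball 0 1"
  unfolding regular_polygon_eq_hull_roots[OF assms]
  by (rule hull_minimal) (auto simp: norm_root_unity[OF _ assms])

text \<open>The unit disc is strictly convex, so a point of the polygon on the unit circle is an extreme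
  point of the polygon, hence one of the vertices.\<close>

lemma regular_polygon_unit_circle:
  assumes "n > 0" "z \<in> regular_polygon n" "cmod z = 1"
  shows "z ^ n = 1"
proof -
  have "z \<notin> open_segment a b" if "a \<in> regular_polygon n" "b \<in> regular_polygon n" for a b
  proof
    assume "z \<in> open_segment a b"
    then have "cmod z < cmod a \<or> cmod z < cmod b"
      using open_segment_furthest_le[of z a b 0] by simp
    with that assms(3) regular_polygon_subset_cball[OF assms(1)] show False
      by force
  qed
  with assms(2) have "z extreme_point_of regular_polygon n"
    by (auto simp: extreme_point_of_def)
  then show ?thesis
    using extreme_point_of_convex_hull regular_polygon_eq_hull_roots[OF assms(1)] by force
qed

text \<open>The vertices \<open>z\<close> sum to 0 and \<open>f\<close> is affine, so the centroid of their images is \<open>f 0\<close>. Each image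
  has distance 1 from \<open>f 0\<close> and lies in the unit disc, and averaging
  \<open>(cmod (f z))\<^sup>2 \<le> 1\<close> over the vertices gives \<open>(cmod (f 0))\<^sup>2 + 1 \<le> 1\<close>.\<close>

lemma polygon_symmetry_fixes_centre:
  assumes "n > 1" and iso: "\<And>x y. dist (f x) (f y) = dist x y"
    and poly: "f ` regular_polygon n = regular_polygon n"
  shows "f 0 = 0"
proof -
  define g where "g z = f z - f 0" for z
  define V where "V = {z :: complex. z ^ n = 1}"
  have "linear g"
    using iso by (intro isometry_linear) (auto simp: g_def dist_norm)
  then have sum0: "(\<Sum>z\<in>V. g z) = 0"
    using linear_sum[of g "\<lambda>z. z" V] sum_roots_unity[OF assms(1)] linear_0[of g]
    by (simp add: V_def)
  have bound: "(cmod (f 0))\<^sup>2 + 2 * (f 0 \<bullet> g z) \<le> 0" if "z \<in> V" for z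
  proof -
    have "z \<in> regular_polygon n"
      using that assms(1) by (auto simp: regular_polygon_eq_hull_roots V_def intro: hull_inc)
    then have "f z \<in> regular_polygon n"
      using poly by blast
    then have "f z \<in> cball 0 1"
      using regular_polygon_subset_cball[of n] assms(1) by auto
    then have "(cmod (f 0 + g z))\<^sup>2 \<le> 1"
      by (simp add: g_def power_le_one)
    moreover have "cmod (g z) = 1"
      using iso[of z 0] norm_root_unity[of z n] that assms(1) by (simp add: g_def dist_norm V_def)
    ultimately show ?thesis
      by (simp add: power2_norm_eq_inner inner_add inner_commute norm_eq_1)
  qed
  have "(\<Sum>z\<in>V. (cmod (f 0))\<^sup>2 + 2 * (f 0 \<bullet> g z)) \<le> 0"
    by (intro sum_nonpos bound)
  also have "(\<Sum>z\<in>V. (cmod (f 0))\<^sup>2 + 2 * (f 0 \<bullet> g z)) =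
      real (card V) * (cmod (f 0))\<^sup>2 + 2 * (f 0 \<bullet> (\<Sum>z\<in>V. g z))"
    by (simp add: sum.distrib inner_sum_right sum_distrib_left)
  also have "card V = n"
    using assms(1) by (simp add: V_def card_roots_unity_eq)
  finally show ?thesis
    using assms(1) by (simp add: sum0 mult_le_0_iff)
qed

lemma polygon_symmetry_image:
  assumes "n > 0" "w ^ n = 1"
  shows "polygon_symmetry e w ` regular_polygon n = regular_polygon n"
proof -
  have "linear (polygon_symmetry e w)"
    by (rule linearI) (auto simp: polygon_symmetry_def algebra_simps)
  moreover have "polygon_symmetry e w ` {z. z ^ n = 1} = {z. z ^ n = 1}"
  proof (rule endo_inj_surj)
    show "finite {z::complex. z ^ n = 1}"
      using assms(1) by (simp add: finite_roots_unity)
    have "polygon_symmetry e w z ^ n = 1" if "z ^ n = 1" for z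
      using that assms(2)
      by (simp add: polygon_symmetry_def power_mult_distrib flip: complex_cnj_power)
    then show "polygon_symmetry e w ` {z. z ^ n = 1} \<subseteq> {z. z ^ n = 1}"
      by blast
    have "w \<noteq> 0"
      using assms by (auto simp: power_0_left)
    then show "inj_on (polygon_symmetry e w) {z. z ^ n = 1}"
      by (auto simp: inj_on_def polygon_symmetry_def)
  qed
  ultimately show ?thesis
    by (simp add: regular_polygon_eq_hull_roots[OF assms(1)] convex_hull_linear_image)
qed

lemma carrier_dihedral_group:
  assumes "n > 1"
  shows "carrier (dihedral_group n) = (\<lambda>(e, w). polygon_symmetry e w) ` (UNIV \<times> {w. w ^ n = 1})"
proof (intro equalityI subsetI)
  fix f assume "f \<in> carrier (dihedral_group n)"
  then have iso: "\<And>x y. dist (f x) (f y) = dist x y"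
    and poly: "f ` regular_polygon n = regular_polygon n"
    by (auto simp: dihedral_group_def plane_isometries_iff)
  have f0: "f 0 = 0"
    using polygon_symmetry_fixes_centre[OF assms iso poly] .
  have "1 \<in> regular_polygon n"
    using assms by (auto simp: regular_polygon_eq_hull_roots intro: hull_inc)
  with poly have "f 1 \<in> regular_polygon n"
    by blast
  moreover have "cmod (f 1) = 1"
    using iso[of 1 0] f0 by simp
  ultimately have "f 1 ^ n = 1"
    using assms by (intro regular_polygon_unit_circle) auto
  moreover have "f = polygon_symmetry True (f 1) \<or> f = polygon_symmetry False (f 1)"
    using isometry_fixing_0_cases[OF f0 iso] by (simp add: polygon_symmetry_def fun_eq_iff)
  then obtain e where "f = polygon_symmetry e (f 1)"
    by blast
  ultimately show "f \<in> (\<lambda>(e, w). polygon_symmetry e w) ` (UNIV \<times> {w. w ^ n = 1})"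
    by (intro image_eqI[where x = "(e, f 1)"]) simp_all
next
  fix f assume "f \<in> (\<lambda>(e, w). polygon_symmetry e w) ` (UNIV \<times> {w. w ^ n = 1})"
  then show "f \<in> carrier (dihedral_group n)"
    using assms polygon_symmetry_image[of n]
    by (force simp: dihedral_group_def intro!: polygon_symmetry_isometry norm_root_unity[of _ n])
qed

lemma dihedral_group_simps [simp]:
  "mult (dihedral_group n) f g = f \<circ> g" "one (dihedral_group n) = id"
  by (simp_all add: dihedral_group_def)

lemma order_dihedral_group:
  assumes "n > 1"
  shows "order (dihedral_group n) = 2 * n"
proof -
  have "w \<noteq> 0" if "w ^ n = 1" for w :: complex
    using that assms by (auto simp: power_0_left)
  then have "inj_on (\<lambda>(e, w). polygon_symmetry e w) (UNIV \<times> {w. w ^ n = 1})"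
    by (auto simp: inj_on_def polygon_symmetry_eq_iff)
  then show ?thesis
    using assms
    by (simp add: order_def carrier_dihedral_group card_image card_cartesian_product
        card_roots_unity_eq)
qed

text \<open>The carrier is the stabiliser of a set of points, hence a subgroup of the isometries.\<close>

lemma group_dihedral_group: "group (dihedral_group n)"
proof -
  have "subgroup {f \<in> carrier plane_isometries. f ` regular_polygon n = regular_polygon n}
          plane_isometries"
  proof (rule isometries.subgroupI)
    fix f
    assume "f \<in> {f \<in> carrier plane_isometries. f ` regular_polygon n = regular_polygon n}"
    then have f: "f \<in> carrier plane_isometries" "f ` regular_polygon n = regular_polygon n"
      by auto
    have "inv\<^bsub>plane_isometries\<^esub> f \<circ> f = id"
      using isometries.l_inv[OF f(1)] by simp
    then have "(inv\<^bsub>plane_isometries\<^esub> f \<circ> f) ` regular_polygon n = regular_polygon n"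
      by simp
    then have "(inv\<^bsub>plane_isometries\<^esub> f) ` regular_polygon n = regular_polygon n"
      by (simp only: image_comp[symmetric] f(2))
    with f(1) show "inv\<^bsub>plane_isometries\<^esub> f
        \<in> {f \<in> carrier plane_isometries. f ` regular_polygon n = regular_polygon n}"
      by simp
  next
    fix f g
    assume "f \<in> {f \<in> carrier plane_isometries. f ` regular_polygon n = regular_polygon n}"
      and "g \<in> {f \<in> carrier plane_isometries. f ` regular_polygon n = regular_polygon n}"
    then show "f \<otimes>\<^bsub>plane_isometries\<^esub> g
        \<in> {f \<in> carrier plane_isometries. f ` regular_polygon n = regular_polygon n}"
      using isometries.m_closed[of f g] image_comp[of f g "regular_polygon n"] by simp
  next
    show "{f \<in> carrier plane_isometries. f ` regular_polygon n = regular_polygon n} \<noteq> {}"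
      using isometries.one_closed by (auto intro!: exI[of _ id])
  qed auto
  then show ?thesis
    unfolding dihedral_group_def by (rule isometries.subgroup_imp_group)
qed

section \<open>Coordinates on the point reflection group\<close>

text \<open>The flag \<open>e\<close> separates translations from half-turns, in parallel to the flag of
  \<open>polygon_symmetry\<close>. The reference half-turn \<open>z \<mapsto> s - z\<close> plays the part of the conjugation.\<close>

definition lattice_isometry ::
  "complex \<Rightarrow> complex \<Rightarrow> complex \<Rightarrow> bool \<Rightarrow> int \<Rightarrow> int \<Rightarrow> complex \<Rightarrow> complex" where
  "lattice_isometry s u v e m n z =
     of_int m * u + of_int n * v + (if e then z else s - z)"

lemma lattice_isometry_comp:
  "lattice_isometry s u v e m n \<circ> lattice_isometry s u v e' m' n' =
     lattice_isometry s u v (e = e')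
       (if e then m + m' else m - m') (if e then n + n' else n - n')"
  by (auto simp: lattice_isometry_def fun_eq_iff algebra_simps)

lemma lattice_isometry_id: "lattice_isometry s u v True 0 0 = id"
  by (auto simp: lattice_isometry_def fun_eq_iff)

lemma lattice_isometry_isometry: "lattice_isometry s u v e m n \<in> carrier plane_isometries"
proof -
  have "bij (lattice_isometry s u v e m n)"
    by (rule o_bij[of "lattice_isometry s u v e (if e then - m else m) (if e then - n else n)"])
      (auto simp: lattice_isometry_comp lattice_isometry_id)
  moreover have "dist (lattice_isometry s u v e m n x) (lattice_isometry s u v e m n y) = dist x y"
    for x y
    by (simp add: lattice_isometry_def dist_norm norm_minus_commute)
  ultimately show ?thesis
    by (simp add: plane_isometries_iff)
qed

text \<open>Translations are inverted by negating the vector, whereas half-turns are involutions.\<close>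

lemma lattice_isometry_inv:
  "inv\<^bsub>plane_isometries\<^esub> lattice_isometry s u v e m n =
     lattice_isometry s u v e (if e then - m else m) (if e then - n else n)"
  by (rule isometries.inv_equality)
    (auto simp: lattice_isometry_comp lattice_isometry_id lattice_isometry_isometry)

lemma lattice_translation_pow:
  "lattice_isometry s u v True m n [^]\<^bsub>plane_isometries\<^esub> (k::nat) =
     lattice_isometry s u v True (int k * m) (int k * n)"
  by (induction k)
    (simp_all add: lattice_isometry_id lattice_isometry_comp algebra_simps)

lemma lattice_translation_int_pow:
  "lattice_isometry s u v True m n [^]\<^bsub>plane_isometries\<^esub> (k::int) =
     lattice_isometry s u v True (k * m) (k * n)"
  by (cases k rule: int_cases2)
    (simp_all add: isometries.int_pow_neg int_pow_int lattice_isometry_isometry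
      lattice_translation_pow lattice_isometry_inv)

lemma sublattice_translation_in_subgroup:
  assumes "subgroup H plane_isometries"
    and "lattice_isometry s u v True a 0 \<in> H" "lattice_isometry s u v True 0 b \<in> H"
  shows "lattice_isometry s u v True (i * a) (j * b) \<in> H"
proof -
  have "lattice_isometry s u v True (i * a) 0 \<in> H" "lattice_isometry s u v True 0 (j * b) \<in> H"
    using isometries.subgroup_int_pow_closed[OF assms(1,2), of i]
      isometries.subgroup_int_pow_closed[OF assms(1,3), of j]
    by (simp_all add: lattice_translation_int_pow)
  from subgroup.m_closed[OF assms(1) this] show ?thesis
    by (simp add: lattice_isometry_comp)
qed

lemma subgroup_sublattice_translations:
  "subgroup (range (\<lambda>(i, j). lattice_isometry s u v True (i * a) (j * b))) plane_isometries"
    (is "subgroup ?H _")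
proof (rule isometries.subgroupI)
  fix f assume "f \<in> ?H"
  then obtain i j where "f = lattice_isometry s u v True (i * a) (j * b)"
    by auto
  then show "inv\<^bsub>plane_isometries\<^esub> f \<in> ?H"
    by (auto simp: lattice_isometry_inv intro!: image_eqI[where x = "(- i, - j)"])
next
  fix f g assume "f \<in> ?H" "g \<in> ?H"
  then obtain i j i' j' where "f = lattice_isometry s u v True (i * a) (j * b)"
    "g = lattice_isometry s u v True (i' * a) (j' * b)"
    by auto
  then show "f \<otimes>\<^bsub>plane_isometries\<^esub> g \<in> ?H"
    by (auto simp: lattice_isometry_comp distrib_right
        intro!: image_eqI[where x = "(i + i', j + j')"])
qed (auto simp: lattice_isometry_isometry)

lemma generate_sublattice_translations:
  "generate plane_isometries {lattice_isometry s u v True 0 b, lattice_isometry s u v True a 0} =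
     range (\<lambda>(i, j). lattice_isometry s u v True (i * a) (j * b))" (is "generate _ ?S = ?H")
proof
  have "?S \<subseteq> ?H"
    by (auto intro: image_eqI[where x = "(0, 1)"] image_eqI[where x = "(1, 0)"])
  then show "generate plane_isometries ?S \<subseteq> ?H"
    by (rule isometries.generate_subgroup_incl[OF _ subgroup_sublattice_translations])
  have "subgroup (generate plane_isometries ?S) plane_isometries"
    by (rule isometries.generate_is_subgroup) (auto simp: lattice_isometry_isometry)
  then show "?H \<subseteq> generate plane_isometries ?S"
    by (auto intro!: sublattice_translation_in_subgroup intro: generate.incl)
qed

lemma lattice_isometry_in_range [simp]:
  "lattice_isometry s u v e m n \<in> range (\<lambda>(e, m, n). lattice_isometry s u v e m n)"
  by (rule image_eqI[where x = "(e, m, n)"]) simp_all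

lemma subgroup_lattice_isometries:
  "subgroup (range (\<lambda>(e, m, n). lattice_isometry s u v e m n)) plane_isometries"
    (is "subgroup ?H _")
proof (rule isometries.subgroupI)
  fix f assume "f \<in> ?H"
  then obtain e m n where "f = lattice_isometry s u v e m n"
    by auto
  then show "inv\<^bsub>plane_isometries\<^esub> f \<in> ?H"
    by (auto simp: lattice_isometry_inv
        intro!: image_eqI[where x = "(e, if e then - m else m, if e then - n else n)"])
next
  fix f g assume "f \<in> ?H" "g \<in> ?H"
  then obtain e m n e' m' n' where
    "f = lattice_isometry s u v e m n" "g = lattice_isometry s u v e' m' n'"
    by auto
  then show "f \<otimes>\<^bsub>plane_isometries\<^esub> g \<in> ?H"
    by (auto simp: lattice_isometry_comp
        intro!: image_eqI[where
          x = "(e = e', if e then m + m' else m - m', if e then n + n' else n - n')"])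
qed (auto simp: lattice_isometry_isometry)

lemma half_turn_eq: "half_turn X Y z = X + Y - z"
  by (simp add: half_turn_def rotation_about_def midpoint_def scaleR_conv_of_real)

lemma half_turns_in_coordinates:
  fixes A B C :: complex
  shows "half_turn A B = lattice_isometry (A + B) (B - C) (C - A) False 0 0"
    and "half_turn A C = lattice_isometry (A + B) (B - C) (C - A) False (- 1) 0"
    and "half_turn B C = lattice_isometry (A + B) (B - C) (C - A) False 0 1"
  by (auto simp: half_turn_eq lattice_isometry_def fun_eq_iff)

lemma generate_half_turns:
  "generate plane_isometries {half_turn A B, half_turn A C, half_turn B C} =
     range (\<lambda>(e, m, n). lattice_isometry (A + B) (B - C) (C - A) e m n)"
    (is "generate _ ?S = range (\<lambda>(e, m, n). ?T e m n)")
proof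
  have "?S \<subseteq> range (\<lambda>(e, m, n). ?T e m n)"
    unfolding half_turns_in_coordinates[where A = A and B = B and C = C] by auto
  then show "generate plane_isometries ?S \<subseteq> range (\<lambda>(e, m, n). ?T e m n)"
    by (rule isometries.generate_subgroup_incl[OF _ subgroup_lattice_isometries])
  have sub: "subgroup (generate plane_isometries ?S) plane_isometries"
    unfolding half_turns_in_coordinates[where A = A and B = B and C = C]
    by (rule isometries.generate_is_subgroup) (auto simp: lattice_isometry_isometry)
  have p1: "?T False 0 0 \<in> generate plane_isometries ?S"
    and p2: "?T False (- 1) 0 \<in> generate plane_isometries ?S"
    and p3: "?T False 0 1 \<in> generate plane_isometries ?S"
    unfolding half_turns_in_coordinates[where A = A and B = B and C = C] by (auto intro: generate.incl)
  have tr: "?T True m n \<in> generate plane_isometries ?S" for m n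
    using sublattice_translation_in_subgroup[OF sub, of _ _ _ 1 1 m n]
      subgroup.m_closed[OF sub p1 p2] subgroup.m_closed[OF sub p3 p1]
    by (simp add: lattice_isometry_comp)
  have "?T e m n \<in> generate plane_isometries ?S" for e m n
    using tr[of m n] subgroup.m_closed[OF sub tr[of m n] p1]
    by (cases e) (simp_all add: lattice_isometry_comp)
  then show "range (\<lambda>(e, m, n). ?T e m n) \<subseteq> generate plane_isometries ?S"
    by auto
qed

lemma carrier_point_reflection_group:
  "carrier (point_reflection_group A B C) =
     range (\<lambda>(e, m, n). lattice_isometry (A + B) (B - C) (C - A) e m n)"
  by (simp add: point_reflection_group_def generate_half_turns)

lemma point_reflection_group_simps [simp]:
  "mult (point_reflection_group A B C) f g = f \<circ> g" "one (point_reflection_group A B C) = id"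
  by (simp_all add: point_reflection_group_def)

lemma group_point_reflection_group: "group (point_reflection_group A B C)"
  unfolding point_reflection_group_def generate_half_turns
  by (rule isometries.subgroup_imp_group[OF subgroup_lattice_isometries])

lemma comma_subgroup_eq:
  "comma_subgroup A B C =
     range (\<lambda>(i, j). lattice_isometry (A + B) (B - C) (C - A) True (i * 4) (j * 3))"
proof -
  let ?T = "lattice_isometry (A + B) (B - C) (C - A)"
  let ?R = "range (\<lambda>(e, m, n). ?T e m n)"
  have "comma_subgroup A B C =
      generate (plane_isometries\<lparr>carrier := ?R\<rparr>) {?T True 0 3, ?T True 4 0}"
    unfolding comma_subgroup_def Let_def point_reflection_group_def generate_half_turns
      isometries.nat_pow_consistent[symmetric]
    by (simp add: half_turns_in_coordinates[where A = A and B = B and C = C]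
        lattice_isometry_comp lattice_translation_pow)
  also have "\<dots> = generate plane_isometries {?T True 0 3, ?T True 4 0}"
    by (rule isometries.generate_consistent[OF _ subgroup_lattice_isometries]) auto
  finally show ?thesis
    by (simp only: generate_sublattice_translations)
qed

text \<open>Comparing heights above the horizontal edge \<open>AB\<close> shows that a vanishing real combination of
  \<open>B - C\<close> and \<open>C - A\<close> has equal coefficients. As the sum of the two vectors is \<open>B - A \<noteq> 0\<close>, both
  coefficients are 0, so the coordinates of an element are determined by its values.\<close>

lemma lattice_isometry_inj:
  assumes "upward_equilateral A B C"
  shows "inj (\<lambda>(e, m, n). lattice_isometry (A + B) (B - C) (C - A) e m n)"
proof -
  have AB: "Im A = Im B" "Re A < Re B" "Im A < Im C"
    using assms by (auto simp: upward_equilateral_def)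
  have coords: "m = m' \<and> n = n'"
    if eq: "of_int m * (B - C) + of_int n * (C - A) = of_int m' * (B - C) + of_int n' * (C - A)"
    for m n m' n'
  proof -
    define p q :: real where "p = of_int (m - m')" and "q = of_int (n - n')"
    have re: "p * (Re B - Re C) + q * (Re C - Re A) = 0"
      and im: "p * (Im B - Im C) + q * (Im C - Im A) = 0"
      using eq by (auto simp: complex_eq_iff p_def q_def algebra_simps)
    from im have "(q - p) * (Im C - Im A) = 0"
      by (simp add: AB(1) algebra_simps)
    with AB have "q = p"
      by simp
    moreover from re \<open>q = p\<close> have "p * (Re B - Re A) = 0"
      by (simp add: algebra_simps)
    with AB have "p = 0"
      by simp
    ultimately show ?thesis
      by (simp add: p_def q_def)
  qed
  have "e = e' \<and> m = m' \<and> n = n'"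
    if eq: "lattice_isometry (A + B) (B - C) (C - A) e m n =
            lattice_isometry (A + B) (B - C) (C - A) e' m' n'"
    for e m n e' m' n'
  proof -
    \<comment> \<open>The difference of the values at 1 and 0 is 1 for a translation and -1 for a half-turn.\<close>
    have "lattice_isometry (A + B) (B - C) (C - A) e m n 1 -
          lattice_isometry (A + B) (B - C) (C - A) e m n 0 = (if e then 1 else - 1)" for e m n
      by (simp add: lattice_isometry_def)
    with eq have "(if e then 1 else - 1 :: complex) = (if e' then 1 else - 1)"
      by metis
    then have "e = e'"
      by (auto split: if_splits)
    with fun_cong[OF eq, of 0] show ?thesis
      using coords[of m n m' n'] by (simp add: lattice_isometry_def split: if_splits)
  qed
  then show ?thesis
    by (auto simp: inj_def)
qed

section \<open>The homomorphism onto the dihedral group\<close>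

definition twelfth_root :: "int \<Rightarrow> complex" where
  "twelfth_root k = cis (2 * pi * of_int k / 12)"

lemma twelfth_root_simps:
  "twelfth_root (j + k) = twelfth_root j * twelfth_root k"
  "cnj (twelfth_root k) = twelfth_root (- k)"
  "twelfth_root k \<noteq> 0"
  by (simp_all add: twelfth_root_def cis_cnj cis_mult add_divide_distrib distrib_left)

lemma twelfth_root_eq_1_iff: "twelfth_root k = 1 \<longleftrightarrow> 12 dvd k"
proof
  assume "twelfth_root k = 1"
  then have "cos (2 * pi * of_int k / 12) = 1"
    by (simp add: twelfth_root_def complex_eq_iff)
  then obtain j :: int where "2 * pi * of_int k / 12 = j * 2 * pi"
    by (auto simp: cos_one_2pi_int)
  then have "(of_int k :: real) = of_int (12 * j)"
    by simp
  then have "k = 12 * j"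
    by (simp only: of_int_eq_iff)
  then show "12 dvd k"
    by simp
next
  assume "12 dvd k"
  then obtain j where "k = 12 * j" ..
  then have "twelfth_root k = cis (2 * pi * of_int j)"
    by (simp add: twelfth_root_def mult.assoc)
  also have "\<dots> = 1"
    by (rule cis_multiple_2pi) simp
  finally show "twelfth_root k = 1" .
qed

lemma range_twelfth_root: "range twelfth_root = {w. w ^ 12 = 1}"
proof (intro equalityI subsetI)
  fix w assume "w \<in> range twelfth_root"
  then obtain k where "w = twelfth_root k" ..
  then have "w ^ 12 = twelfth_root (12 * k)"
    by (simp add: twelfth_root_def Complex.DeMoivre)
  then show "w \<in> {w. w ^ 12 = 1}"
    by (simp add: twelfth_root_eq_1_iff)
next
  fix w :: complex assume "w \<in> {w. w ^ 12 = 1}"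
  then obtain k where "w = cis (2 * pi * real k / real 12)"
    using bij_betw_imp_surj_on[OF Complex.bij_betw_roots_unity[of 12]] by fastforce
  then have "w = twelfth_root (int k)"
    by (simp add: twelfth_root_def)
  then show "w \<in> range twelfth_root"
    by blast
qed

text \<open>The inverse of the parametrization reads off the coordinates of an element of the point
  reflection group.\<close>

definition to_dihedral ::
  "complex \<Rightarrow> complex \<Rightarrow> complex \<Rightarrow> (complex \<Rightarrow> complex) \<Rightarrow> complex \<Rightarrow> complex" where
  "to_dihedral A B C f =
     (case inv_into UNIV (\<lambda>(e, m, n). lattice_isometry (A + B) (B - C) (C - A) e m n) f of
        (e, m, n) \<Rightarrow> polygon_symmetry e (twelfth_root (3 * m + 4 * n)))"

lemma to_dihedral_lattice_isometry:
  assumes "upward_equilateral A B C"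
  shows "to_dihedral A B C (lattice_isometry (A + B) (B - C) (C - A) e m n) =
           polygon_symmetry e (twelfth_root (3 * m + 4 * n))"
  using inv_f_f[OF lattice_isometry_inj[OF assms], of "(e, m, n)"]
  by (simp add: to_dihedral_def)

lemma group_hom_to_dihedral:
  assumes "upward_equilateral A B C"
  shows "group_hom (point_reflection_group A B C) (dihedral_group 12) (to_dihedral A B C)"
proof -
  let ?T = "lattice_isometry (A + B) (B - C) (C - A)"
  have "twelfth_root k ^ 12 = 1" for k
    using range_twelfth_root by blast
  then have "to_dihedral A B C f \<in> carrier (dihedral_group 12)"
    if "f \<in> carrier (point_reflection_group A B C)" for f
    using that
    by (force simp: carrier_point_reflection_group carrier_dihedral_group
        to_dihedral_lattice_isometry[OF assms])
  moreover have "to_dihedral A B C (?T e m n \<circ> ?T e' m' n') =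
      to_dihedral A B C (?T e m n) \<circ> to_dihedral A B C (?T e' m' n')" for e m n e' m' n'
    by (cases e)
      (simp_all add: lattice_isometry_comp to_dihedral_lattice_isometry[OF assms]
        polygon_symmetry_comp twelfth_root_simps(2) algebra_simps flip: twelfth_root_simps(1))
  ultimately have "to_dihedral A B C \<in> hom (point_reflection_group A B C) (dihedral_group 12)"
    by (auto simp: hom_def carrier_point_reflection_group)
  then show ?thesis
    by (simp add: group_hom_def group_hom_axioms_def group_dihedral_group
        group_point_reflection_group)
qed

text \<open>The values \<open>3 m + 4 n\<close> exhaust the integers because \<open>k = 3 (- k) + 4 k\<close>.\<close>

lemma to_dihedral_surj:
  assumes "upward_equilateral A B C"
  shows "to_dihedral A B C ` carrier (point_reflection_group A B C) =
           carrier (dihedral_group 12)"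
proof
  show "to_dihedral A B C ` carrier (point_reflection_group A B C) \<subseteq> carrier (dihedral_group 12)"
    using group_hom.hom_closed[OF group_hom_to_dihedral[OF assms]] by blast
  show "carrier (dihedral_group 12) \<subseteq> to_dihedral A B C ` carrier (point_reflection_group A B C)"
  proof
    fix f assume "f \<in> carrier (dihedral_group 12)"
    then obtain e w where f: "f = polygon_symmetry e w" and "w ^ 12 = 1"
      by (auto simp: carrier_dihedral_group)
    then obtain k where "w = twelfth_root k"
      using range_twelfth_root by blast
    with f have "f = to_dihedral A B C (lattice_isometry (A + B) (B - C) (C - A) e (- k) k)"
      by (simp add: to_dihedral_lattice_isometry[OF assms])
    then show "f \<in> to_dihedral A B C ` carrier (point_reflection_group A B C)"
      unfolding carrier_point_reflection_group
      by (rule image_eqI[OF _ lattice_isometry_in_range])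
  qed
qed

lemma kernel_to_dihedral:
  assumes "upward_equilateral A B C"
  shows "kernel (point_reflection_group A B C) (dihedral_group 12) (to_dihedral A B C) =
           comma_subgroup A B C"
proof -
  let ?T = "lattice_isometry (A + B) (B - C) (C - A)"
  have ker: "to_dihedral A B C (?T e m n) = id \<longleftrightarrow> e \<and> 4 dvd m \<and> 3 dvd n" for e m n
  proof -
    \<comment> \<open>The coprimality of 3 and 4 separates the divisibility by 12 into one condition on each
        coordinate.\<close>
    have "12 dvd 3 * m + 4 * n \<longleftrightarrow> 4 dvd m \<and> 3 dvd n"
      by presburger
    then show ?thesis
      by (simp only: to_dihedral_lattice_isometry[OF assms] twelfth_root_simps(3)
          polygon_symmetry_eq_id_iff twelfth_root_eq_1_iff not_False_eq_True)
  qed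
  have "kernel (point_reflection_group A B C) (dihedral_group 12) (to_dihedral A B C) =
      {?T True m n | m n. 4 dvd m \<and> 3 dvd n}"
    by (auto simp: kernel_def carrier_point_reflection_group ker) blast
  also have "\<dots> = range (\<lambda>(i, j). ?T True (i * 4) (j * 3))"
    by (auto simp: dvd_def mult.commute image_iff)
  finally show ?thesis
    by (simp add: comma_subgroup_eq)
qed

theorem proposition6p2:
  fixes A B C :: complex
  defines "P \<equiv> point_reflection_group A B C"
    and "K \<equiv> comma_subgroup A B C"
  assumes "upward_equilateral A B C"
  shows "K \<lhd> P \<and>
         card (rcosets\<^bsub>P\<^esub> K) = 24 \<and>
         P Mod K \<cong> dihedral_group 12 \<and>
         Coset.order (dihedral_group 12) = 24"
proof -
  interpret group_hom P "dihedral_group 12" "to_dihedral A B C"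
    unfolding P_def by (rule group_hom_to_dihedral[OF assms(3)])
  have kernel: "kernel P (dihedral_group 12) (to_dihedral A B C) = K"
    unfolding P_def K_def by (rule kernel_to_dihedral[OF assms(3)])
  have "P Mod K \<cong> dihedral_group 12"
    using FactGroup_iso to_dihedral_surj[OF assms(3), folded P_def] by (simp only: kernel)
  moreover from iso_same_card[OF this]
  have "card (rcosets\<^bsub>P\<^esub> K) = order (dihedral_group 12)"
    by (simp add: FactGroup_def order_def)
  ultimately show ?thesis
    using normal_kernel by (simp add: kernel order_dihedral_group)
qed

end
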